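(* Let $0<\alpha<1$, $D>0$, $T>0$, and let $u$ be a solution of the fractional subdiffusion problem $$\frac{\partial^\alpha u(x,t)}{\partial t^\alpha}=D\frac{\partial^2 u(x,t)}{\partial x^2}+F(x,t),\ (x,t)\in[0,1]\times[0,T],\qquad u(x,0)=u_0(x),\ u(0,t)=u_1(t),\ u(1,t)=u_2(t).$$ For positive integers $N\ge 2$ and $M$ let $h=1/N$, $\tau=T/M$, and let $U_n^m$ be the numerical solution computed by the finite difference scheme described in the context. Assume that the truncation error of the scheme at each grid point $(nh,m\tau)$ has the form $A_n^m\tau^{2-\alpha}+B_n^m h^2$, where $|A_n^m|$ and $|B_n^m|$ are bounded by a constant independent of $n,m,N,M$. Let $e_n^m=u(nh,m\tau)-U_n^m$ and $\mathcal{E}^m=(e_1^m,\dots,e_{N-1}^m)^T$, with the maximum norm $\|\mathcal{E}^m\|=\max_{1\le n\le N-1}|e_n^m|$. Then there is a constant $A>0$, independent of $N$, $M$ and $m$, such that for all $m=1,\dots,M$ $$\left\| \mathcal{E}^m\right\|\leq 2A\, m^\alpha \tau^\alpha\left(\tau^{2-\alpha}+h^2\right).$$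
   Context: $\frac{\partial^\alpha u}{\partial t^\alpha}(x,t)=\frac{1}{\Gamma(1-\alpha)}\int_0^t (t-\xi)^{-\alpha}\frac{\partial u}{\partial \xi}(x,\xi)\,d\xi$ is the Caputo derivative in time; $\zeta$ is the (analytically continued) Riemann zeta function. Write $u_n^m=u(nh,m\tau)$, $F_n^m=F(nh,m\tau)$. Weights. For $m\ge 2$ put $$W_m=\zeta(\alpha)-\frac{m^{1-\alpha}}{1-\alpha}+2^\alpha\Big(\sum_{k=1}^{m}\frac{1}{(2k-1)^\alpha}-\zeta(\alpha)\Big),$$ and let $\tilde\sigma_0=2^\alpha-(2^\alpha-1)\zeta(\alpha)$, $\tilde\sigma_1=(2/3)^\alpha-2^\alpha+(2^\alpha-1)\zeta(\alpha)$, $\tilde\sigma_k=2^\alpha\big((2k+1)^{-\alpha}-(2k-1)^{-\alpha}\big)$ for $2\le k\le m-1$. The weights used on layer $m$ are $\sigma_k^{(\alpha)}=\tilde\sigma_k$ for $0\le k\le m-2$, $\sigma_{m-1}^{(\alpha)}=\tilde\sigma_{m-1}-W_m$, and $\sigma_m^{(\alpha)}=-\frac{2^\alpha}{(2m-1)^\alpha}+W_m$. Scheme. Set $U_n^0=u_0(nh)$, $U_0^m=u_1(m\tau)$, $U_N^m=u_2(m\tau)$. On the first layer, with $\tilde\eta=\Gamma(2-\alpha)D\tau^\alpha/h^2$, for $1\le n\le N-1$, $$-\tilde\eta U_{n-1}^1+(1+2\tilde\eta)U_n^1-\tilde\eta U_{n+1}^1=U_n^0+\Gamma(2-\alpha)\tau^\alpha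 F_n^1.$$ On layers $2\le m\le M$, with $\eta=\Gamma(1-\alpha)D\tau^\alpha/h^2$, for $1\le n\le N-1$, $$-\eta U_{n-1}^m+(\sigma_0^{(\alpha)}+2\eta)U_n^m-\eta U_{n+1}^m=-\sum_{k=1}^m\sigma_k^{(\alpha)}U_n^{m-k}+\Gamma(1-\alpha)\tau^\alpha F_n^m.$$ Truncation error at $(nh,m\tau)$: for $m\ge2$ it is $$\frac{1}{\Gamma(1-\alpha)\tau^\alpha}\sum_{k=0}^m\sigma_k^{(\alpha)}u_n^{m-k}-D\frac{u_{n-1}^m-2u_n^m+u_{n+1}^m}{h^2}-F_n^m,$$ and for $m=1$ it is $$\frac{u_n^1-u_n^0}{\Gamma(2-\alpha)\tau^\alpha}-D\frac{u_{n-1}^1-2u_n^1+u_{n+1}^1}{h^2}-F_n^1.$$ *)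

theory Defs
  imports "HOL-Complex_Analysis.Complex_Analysis"
begin

section \<open>The Riemann zeta function\<close>

text \<open>
  The value at \<open>s \<noteq> 1\<close> of the analytic continuation of \<open>\<Sum>n\<ge>1. 1 / n\<^sup>s\<close> from \<open>Re w > 1\<close> to a
  punctured half-plane \<open>{w. c < Re w} - {1}\<close> containing \<open>s\<close>. These punctured half-planes are
  connected and nested, so the value depends neither on \<open>c\<close> nor on \<open>f\<close>; the value at \<open>1\<close> is
  unspecified.
\<close>
definition zeta :: "complex \<Rightarrow> complex" where
  "zeta s = (THE z. \<exists>c f. c < Re s \<and> f holomorphic_on ({w. c < Re w} - {1}) \<and>
     (\<forall>w. 1 < Re w \<longrightarrow> (\<lambda>n. 1 / of_nat (Suc n) powr w) sums f w) \<and> z = f s)"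

lemma zeta_eqI:
  assumes "f holomorphic_on ({w. c < Re w} - {1})"
    and "\<And>w. 1 < Re w \<Longrightarrow> (\<lambda>n. 1 / of_nat (Suc n) powr w) sums f w"
    and "c < Re s" "s \<noteq> 1"
  shows "zeta s = f s"
  unfolding zeta_def
proof (rule the_equality)
  show "\<exists>c g. c < Re s \<and> g holomorphic_on ({w. c < Re w} - {1}) \<and>
     (\<forall>w. 1 < Re w \<longrightarrow> (\<lambda>n. 1 / of_nat (Suc n) powr w) sums g w) \<and> f s = g s"
    using assms by blast
next
  fix z assume "\<exists>c g. c < Re s \<and> g holomorphic_on ({w. c < Re w} - {1}) \<and>
     (\<forall>w. 1 < Re w \<longrightarrow> (\<lambda>n. 1 / of_nat (Suc n) powr w) sums g w) \<and> z = g s"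
  then obtain c' g where g: "c' < Re s" "g holomorphic_on ({w. c' < Re w} - {1})"
    "\<And>w. 1 < Re w \<Longrightarrow> (\<lambda>n. 1 / of_nat (Suc n) powr w) sums g w" "z = g s"
    by blast
  define d where "d = max c c'"
  define S where "S = {w::complex. d < Re w} - {1}"
  define S' where "S' = {w::complex. max d 1 < Re w}"
  have "g s = f s"
  proof (rule analytic_continuation_open[of S' S g f s])
    show "open S'" unfolding S'_def by (rule open_halfspace_Re_gt)
    show "open S" unfolding S_def by (simp add: open_halfspace_Re_gt open_delete)
    have "complex_of_real (max d 1 + 1) \<in> S'" by (auto simp: S'_def max_def)
    then show "S' \<noteq> {}" by blast
    have "connected {w::complex. d < Re w}"
      by (intro convex_connected convex_halfspace_Re_gt)
    then show "connected S"
      unfolding S_def by (intro connected_open_delete) (auto simp: open_halfspace_Re_gt)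
    show "S' \<subseteq> S" by (auto simp: S_def S'_def)
    show "g holomorphic_on S" "f holomorphic_on S"
      using assms(1) g(2) by (auto simp: S_def d_def elim!: holomorphic_on_subset)
    show "g w = f w" if "w \<in> S'" for w
      using that assms(2)[of w] g(3)[of w] by (auto simp: S'_def intro: sums_unique2)
    show "s \<in> S" using assms(3,4) g(1) by (auto simp: S_def d_def)
  qed
  then show "z = f s" using g(4) by simp
qed

text \<open>
  The continuation to \<open>Re s > 0\<close>, obtained by comparing the series with the integral of
  \<open>x powr - s\<close> over \<open>[n + 1, n + 2]\<close>.
\<close>
definition zeta_term :: "nat \<Rightarrow> complex \<Rightarrow> complex" where
  "zeta_term n s = 1 / of_nat (Suc n) powr s -
     (of_nat (Suc (Suc n)) powr (1 - s) - of_nat (Suc n) powr (1 - s)) / (1 - s)"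

lemma norm_zeta_term_le:
  assumes "0 < Re s" "s \<noteq> 1"
  shows "norm (zeta_term n s) \<le> norm s * real (Suc n) powr (- Re s - 1)"
proof -
  define a where "a = complex_of_nat (Suc n)"
  define B where "B = norm s * real (Suc n) powr (- Re s - 1)"
  define S where "S = closed_segment a (a + 1)"
  have S: "Im z = 0 \<and> real (Suc n) \<le> Re z \<and> norm (z - a) \<le> 1" if "z \<in> S" for z
  proof -
    from that obtain t where "0 \<le> t" "t \<le> 1" "z = (1 - t) *\<^sub>R a + t *\<^sub>R (a + 1)"
      unfolding S_def closed_segment_def by blast
    then have "z = a + of_real t" by (simp add: scaleR_conv_of_real algebra_simps)
    then show ?thesis using \<open>0 \<le> t\<close> \<open>t \<le> 1\<close> by (simp add: a_def)
  qed
  have conv: "convex S" and mem: "a \<in> S" "a + 1 \<in> S" by (auto simp: S_def)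
  have nonpos: "z \<notin> \<real>\<^sub>\<le>\<^sub>0" if "z \<in> S" for z
    using S[OF that] by (auto simp: complex_nonpos_Reals_iff)
  have nrm: "norm (z powr w) \<le> real (Suc n) powr Re w" if "z \<in> S" "Re w \<le> 0" for z w
  proof -
    have "norm (z powr w) = Re z powr Re w"
      using S[OF that(1)] by (intro norm_powr_real_powr) (auto simp: complex_is_Real_iff)
    also have "\<dots> \<le> real (Suc n) powr Re w"
      using S[OF that(1)] that(2) by (intro powr_mono2') auto
    finally show ?thesis .
  qed
  have lip: "norm (z powr (- s) - a powr (- s)) \<le> B" if "z \<in> S" for z
  proof -
    have "norm (z powr (- s) - a powr (- s)) \<le> B * norm (z - a)"
    proof (rule field_differentiable_bound[OF conv _ _ that mem(1)])
      fix x assume x: "x \<in> S"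
      show "((\<lambda>z. z powr (- s)) has_field_derivative (- s * x powr (- s - 1))) (at x within S)"
        using has_field_derivative_powr[OF nonpos[OF x], of "- s"]
        by (auto intro: has_field_derivative_at_within)
      show "norm (- s * x powr (- s - 1)) \<le> B"
        using nrm[OF x, of "- s - 1"] assms by (auto simp: norm_mult B_def intro!: mult_left_mono)
    qed
    also have "\<dots> \<le> B * 1" using S[OF that] by (intro mult_left_mono) (auto simp: B_def)
    finally show ?thesis by simp
  qed
  define G where "G = (\<lambda>z. z * a powr (- s) - z powr (1 - s) / (1 - s))"
  have "norm (G (a + 1) - G a) \<le> B * norm (a + 1 - a)"
  proof (rule field_differentiable_bound[OF conv _ _ mem(2,1)])
    fix x assume x: "x \<in> S"
    have "((\<lambda>z. z powr (1 - s)) has_field_derivative ((1 - s) * x powr (- s))) (at x within S)"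
      using has_field_derivative_powr[OF nonpos[OF x], of "1 - s"]
      by (auto intro: has_field_derivative_at_within)
    from DERIV_cdivide[OF this, of "1 - s"]
    have "((\<lambda>z. z powr (1 - s) / (1 - s)) has_field_derivative x powr (- s)) (at x within S)"
      using assms by simp
    then show "(G has_field_derivative (a powr (- s) - x powr (- s))) (at x within S)"
      unfolding G_def
      by (intro DERIV_diff) (auto intro!: derivative_eq_intros)
    show "norm (a powr (- s) - x powr (- s)) \<le> B"
      using lip[OF x] by (simp add: norm_minus_commute)
  qed
  moreover have "G (a + 1) - G a = zeta_term n s"
    by (simp add: G_def zeta_term_def a_def powr_minus divide_simps add_ac)
       (simp add: algebra_simps)?
  ultimately show ?thesis by (simp add: B_def)
qed

lemma zeta_continuation:
  obtains f where "f holomorphic_on ({s. 0 < Re s} - {1})"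
    "\<And>s. 1 < Re s \<Longrightarrow> (\<lambda>n. 1 / of_nat (Suc n) powr s) sums f s"
    "\<And>s. 0 < Re s \<Longrightarrow> s \<noteq> 1 \<Longrightarrow> (\<lambda>n. zeta_term n s) sums (f s - 1 / (s - 1))"
proof -
  define S where "S = {s::complex. 0 < Re s} - {1}"
  have opS: "open S" unfolding S_def by (simp add: open_halfspace_Re_gt open_delete)
  obtain g where g: "\<forall>s \<in> S. ((\<lambda>n. zeta_term n s) sums g s) \<and> g field_differentiable (at s)"
  proof (rule series_differentiable_comparison_complex[OF opS])
    show "zeta_term n field_differentiable (at s)" if "s \<in> S" for n s
    proof -
      have "zeta_term n holomorphic_on S"
        unfolding zeta_term_def S_def by (intro holomorphic_intros) auto
      then show ?thesis using opS that by (simp add: holomorphic_on_imp_differentiable_at)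
    qed
  next
    fix s assume s: "s \<in> S"
    define d where "d = Re s / 2"
    define h where "h = (\<lambda>n. complex_of_real ((norm s + d) * real (Suc n) powr (- d - 1)))"
    have d: "d > 0" using s by (simp add: d_def S_def)
    have "summable (\<lambda>n. real n powr (- d - 1))"
      using d by (simp add: summable_real_powr_iff)
    then have sumh: "summable h"
      unfolding h_def by (intro summable_of_real summable_mult) (subst summable_Suc_iff)
    moreover have "range h \<subseteq> \<real>\<^sub>\<ge>\<^sub>0"
      using d by (auto simp: h_def simp del: of_real_mult of_real_add)
    moreover have "norm (zeta_term n y) \<le> norm (h n)" if "y \<in> ball s d \<inter> S" for n y
    proof -
      have y: "0 < Re y" "y \<noteq> 1" "norm (s - y) < d" using that by (auto simp: S_def dist_norm)
      have "Re s - Re y \<le> norm (s - y)" using complex_Re_le_cmod[of "s - y"] by simp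
      then have "d \<le> Re y" using y by (simp add: d_def)
      moreover have "norm y \<le> norm s + d"
        using norm_triangle_ineq2[of y s] y by (simp add: norm_minus_commute)
      ultimately have "norm y * real (Suc n) powr (- Re y - 1) \<le>
          (norm s + d) * real (Suc n) powr (- d - 1)"
        using d by (intro mult_mono powr_mono) auto
      also have "\<dots> = norm (h n)"
        using d unfolding h_def norm_of_real by simp
      finally show ?thesis using norm_zeta_term_le[OF y(1,2), of n] by linarith
    qed
    ultimately show "\<exists>d h. 0 < d \<and> summable h \<and> range h \<subseteq> \<real>\<^sub>\<ge>\<^sub>0 \<and>
        (\<forall>\<^sub>F n in sequentially. \<forall>y\<in>ball s d \<inter> S. cmod (zeta_term n y) \<le> cmod (h n))"
      using d by (intro exI[of _ d] exI[of _ h]) (simp add: eventually_sequentially)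
  qed
  show ?thesis
  proof (rule that[of "\<lambda>s. g s + 1 / (s - 1)"])
    have "g holomorphic_on S"
      using g by (auto simp: holomorphic_on_def intro: field_differentiable_at_within)
    then show "(\<lambda>s. g s + 1 / (s - 1)) holomorphic_on ({s. 0 < Re s} - {1})"
      unfolding S_def by (intro holomorphic_intros) auto
    show "(\<lambda>n. zeta_term n s) sums (g s + 1 / (s - 1) - 1 / (s - 1))"
      if "0 < Re s" "s \<noteq> 1" for s
      using g that by (auto simp: S_def)
    show "(\<lambda>n. 1 / of_nat (Suc n) powr s) sums (g s + 1 / (s - 1))" if "1 < Re s" for s
    proof -
      define b where "b = (\<lambda>n. of_nat (Suc n) powr (1 - s) / (1 - s))"
      have "(\<lambda>n. norm (b n)) = (\<lambda>n. real (Suc n) powr (1 - Re s) / norm (1 - s))"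
        by (auto simp: b_def norm_divide norm_powr_real_powr simp del: of_nat_Suc)
      moreover have "(\<lambda>n. real (Suc n) powr (1 - Re s)) \<longlonglongrightarrow> 0"
        using that
        by (intro tendsto_neg_powr filterlim_compose[OF filterlim_real_sequentially filterlim_Suc])
           auto
      then have "(\<lambda>n. real (Suc n) powr (1 - Re s) / norm (1 - s)) \<longlonglongrightarrow> 0"
        by (rule tendsto_divide_zero)
      ultimately have "(\<lambda>n. norm (b n)) \<longlonglongrightarrow> 0" by simp
      then have "b \<longlonglongrightarrow> 0" by (rule tendsto_norm_zero_cancel)
      have "b 0 = - (1 / (s - 1))" using minus_divide_right[of 1 "s - 1"] by (simp add: b_def)
      with telescope_sums[OF \<open>b \<longlonglongrightarrow> 0\<close>] have "(\<lambda>n. b (Suc n) - b n) sums (1 / (s - 1))"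
        by simp
      moreover have "(\<lambda>n. zeta_term n s) sums g s" using g that by (auto simp: S_def)
      ultimately have "(\<lambda>n. zeta_term n s + (b (Suc n) - b n)) sums (g s + 1 / (s - 1))"
        by (intro sums_add)
      then show ?thesis by (simp add: zeta_term_def b_def diff_divide_distrib)
    qed
  qed
qed

lemma holomorphic_zeta: "zeta holomorphic_on ({s. 0 < Re s} - {1})"
proof -
  obtain f where f: "f holomorphic_on ({s. 0 < Re s} - {1})"
    "\<And>s. 1 < Re s \<Longrightarrow> (\<lambda>n. 1 / of_nat (Suc n) powr s) sums f s"
    using zeta_continuation by metis
  show ?thesis
    by (rule holomorphic_transform[OF f(1)]) (use zeta_eqI[OF f] in auto)
qed

lemma zeta_sums: "1 < Re s \<Longrightarrow> (\<lambda>n. 1 / of_nat (Suc n) powr s) sums zeta s"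
proof -
  assume s: "1 < Re s"
  obtain f where f: "f holomorphic_on ({s. 0 < Re s} - {1})"
    "\<And>s. 1 < Re s \<Longrightarrow> (\<lambda>n. 1 / of_nat (Suc n) powr s) sums f s"
    using zeta_continuation by metis
  have "zeta s = f s" using s by (intro zeta_eqI[OF f]) auto
  then show ?thesis using f(2)[OF s] by simp
qed

lemma zeta_term_sums:
  assumes "0 < Re s" "s \<noteq> 1"
  shows "(\<lambda>n. zeta_term n s) sums (zeta s - 1 / (s - 1))"
proof -
  obtain f where f: "f holomorphic_on ({s. 0 < Re s} - {1})"
    "\<And>s. 1 < Re s \<Longrightarrow> (\<lambda>n. 1 / of_nat (Suc n) powr s) sums f s"
    "\<And>s. 0 < Re s \<Longrightarrow> s \<noteq> 1 \<Longrightarrow> (\<lambda>n. zeta_term n s) sums (f s - 1 / (s - 1))"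
    using zeta_continuation by metis
  show ?thesis using f(3)[OF assms] zeta_eqI[OF f(1,2) assms] by simp
qed


section \<open>The fractional subdiffusion problem\<close>

definition caputo :: "real \<Rightarrow> (real \<Rightarrow> real) \<Rightarrow> real \<Rightarrow> real" where
  "caputo \<alpha> g t =
     1 / Gamma (1 - \<alpha>) * integral {0..t} (\<lambda>\<xi>. (t - \<xi>) powr (- \<alpha>) * deriv g \<xi>)"

text \<open>
  Well-definedness of \<open>caputo \<alpha> g t\<close>, without which \<open>deriv\<close> and \<open>integral\<close> return unspecified
  or default values. Differentiability is only required in the interior, so that weakly singular
  behaviour at \<open>0\<close> is not excluded; the endpoints do not influence the integral.
\<close>
definition has_caputo :: "real \<Rightarrow> (real \<Rightarrow> real) \<Rightarrow> real \<Rightarrow> bool" where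
  "has_caputo \<alpha> g t \<longleftrightarrow>
     (\<forall>\<xi>\<in>{0<..<t}. g differentiable (at \<xi>)) \<and>
     (\<lambda>\<xi>. (t - \<xi>) powr (- \<alpha>) * deriv g \<xi>) integrable_on {0..t}"

text \<open>Space derivatives at \<open>x = 0\<close> and \<open>x = 1\<close> are one-sided.\<close>
definition subdiffusion_solution ::
  "real \<Rightarrow> real \<Rightarrow> real \<Rightarrow> (real \<Rightarrow> real \<Rightarrow> real) \<Rightarrow> (real \<Rightarrow> real) \<Rightarrow> (real \<Rightarrow> real) \<Rightarrow> (real \<Rightarrow> real) \<Rightarrow>
    (real \<Rightarrow> real \<Rightarrow> real) \<Rightarrow> bool" where
  "subdiffusion_solution \<alpha> D T F u0 u1 u2 u \<longleftrightarrow>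
     (\<exists>u\<^sub>x u\<^sub>x\<^sub>x. \<forall>x\<in>{0..1}. \<forall>t\<in>{0..T}.
        ((\<lambda>y. u y t) has_real_derivative u\<^sub>x x t) (at x within {0..1}) \<and>
        ((\<lambda>y. u\<^sub>x y t) has_real_derivative u\<^sub>x\<^sub>x x t) (at x within {0..1}) \<and>
        has_caputo \<alpha> (\<lambda>s. u x s) t \<and>
        caputo \<alpha> (\<lambda>s. u x s) t = D * u\<^sub>x\<^sub>x x t + F x t) \<and>
     (\<forall>x\<in>{0..1}. u x 0 = u0 x) \<and>
     (\<forall>t\<in>{0..T}. u 0 t = u1 t \<and> u 1 t = u2 t)"

section \<open>The finite difference scheme\<close>

definition rzeta :: "real \<Rightarrow> real" where
  "rzeta \<alpha> = Re (zeta (complex_of_real \<alpha>))"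

lemma of_real_rzeta:
  assumes "0 < \<alpha>" "\<alpha> \<noteq> 1"
  shows "complex_of_real (rzeta \<alpha>) = zeta (complex_of_real \<alpha>)"
proof -
  let ?s = "complex_of_real \<alpha>"
  have p: "Im (of_nat (Suc n) powr complex_of_real x) = 0" for n x
    using powr_of_real[of "real (Suc n)" x] by (metis Im_complex_of_real of_nat_0_le_iff of_real_of_nat_eq)
  have "of_nat (Suc n) powr (1 - ?s) \<in> \<real>" "of_nat (Suc n) powr ?s \<in> \<real>" for n
    using p[of n "1 - \<alpha>"] p[of n \<alpha>] by (auto simp: complex_is_Real_iff simp del: of_nat_Suc)
  then have "zeta_term n ?s \<in> \<real>" for n
    unfolding zeta_term_def by (intro Reals_diff Reals_divide) auto
  then have "(\<lambda>n. Im (zeta_term n ?s)) = (\<lambda>n. 0)" by (auto simp: complex_is_Real_iff)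
  moreover have "(\<lambda>n. Im (zeta_term n ?s)) sums Im (zeta ?s - 1 / (?s - 1))"
    using assms by (intro sums_Im zeta_term_sums) auto
  ultimately have "Im (zeta ?s - 1 / (?s - 1)) = 0" by (metis sums_0 sums_unique2)
  moreover have "Im (1 / (?s - 1)) = 0"
    by (metis Im_complex_of_real of_real_1 of_real_diff of_real_divide)
  ultimately show ?thesis by (simp add: rzeta_def complex_eq_iff)
qed

definition W :: "real \<Rightarrow> nat \<Rightarrow> real" where
  "W \<alpha> m = rzeta \<alpha> - real m powr (1 - \<alpha>) / (1 - \<alpha>) +
     2 powr \<alpha> * ((\<Sum>k=1..m. 1 / (2 * real k - 1) powr \<alpha>) - rzeta \<alpha>)"

definition sigma_tilde :: "real \<Rightarrow> nat \<Rightarrow> real" where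
  "sigma_tilde \<alpha> k =
    (if k = 0 then 2 powr \<alpha> - (2 powr \<alpha> - 1) * rzeta \<alpha>
     else if k = 1 then (2 / 3) powr \<alpha> - 2 powr \<alpha> + (2 powr \<alpha> - 1) * rzeta \<alpha>
     else 2 powr \<alpha> * ((2 * real k + 1) powr (- \<alpha>) - (2 * real k - 1) powr (- \<alpha>)))"

text \<open>The weights on layer \<open>m \<ge> 2\<close>; only the values for \<open>k \<le> m\<close> are used.\<close>
definition sigma :: "real \<Rightarrow> nat \<Rightarrow> nat \<Rightarrow> real" where
  "sigma \<alpha> m k =
    (if k \<le> m - 2 then sigma_tilde \<alpha> k
     else if k = m - 1 then sigma_tilde \<alpha> (m - 1) - W \<alpha> m
     else - (2 powr \<alpha> / (2 * real m - 1) powr \<alpha>) + W \<alpha> m)"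

text \<open>\<open>U n m\<close> is the numerical value at the space index \<open>n\<close> and the time layer \<open>m\<close>.\<close>
definition numerical_solution ::
  "real \<Rightarrow> real \<Rightarrow> real \<Rightarrow> (real \<Rightarrow> real \<Rightarrow> real) \<Rightarrow> (real \<Rightarrow> real) \<Rightarrow> (real \<Rightarrow> real) \<Rightarrow> (real \<Rightarrow> real) \<Rightarrow>
    nat \<Rightarrow> nat \<Rightarrow> (nat \<Rightarrow> nat \<Rightarrow> real) \<Rightarrow> bool" where
  "numerical_solution \<alpha> D T F u0 u1 u2 N M U \<longleftrightarrow>
    (let h = 1 / real N; \<tau> = T / real M;
         \<eta>1 = Gamma (2 - \<alpha>) * D * \<tau> powr \<alpha> / h\<^sup>2;
         \<eta> = Gamma (1 - \<alpha>) * D * \<tau> powr \<alpha> / h\<^sup>2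
     in (\<forall>n\<in>{0..N}. U n 0 = u0 (real n * h)) \<and>
        (\<forall>m\<in>{0..M}. U 0 m = u1 (real m * \<tau>) \<and> U N m = u2 (real m * \<tau>)) \<and>
        (\<forall>n\<in>{1..N-1}.
           - \<eta>1 * U (n - 1) 1 + (1 + 2 * \<eta>1) * U n 1 - \<eta>1 * U (n + 1) 1 =
           U n 0 + Gamma (2 - \<alpha>) * \<tau> powr \<alpha> * F (real n * h) (1 * \<tau>)) \<and>
        (\<forall>m\<in>{2..M}. \<forall>n\<in>{1..N-1}.
           - \<eta> * U (n - 1) m + (sigma \<alpha> m 0 + 2 * \<eta>) * U n m - \<eta> * U (n + 1) m =
           - (\<Sum>k=1..m. sigma \<alpha> m k * U n (m - k)) +
             Gamma (1 - \<alpha>) * \<tau> powr \<alpha> * F (real n * h) (real m * \<tau>)))"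

text \<open>The truncation error at the grid point with indices \<open>1 \<le> n \<le> N - 1\<close> and \<open>1 \<le> m \<le> M\<close>.\<close>
definition truncation_error ::
  "real \<Rightarrow> real \<Rightarrow> real \<Rightarrow> (real \<Rightarrow> real \<Rightarrow> real) \<Rightarrow> (real \<Rightarrow> real \<Rightarrow> real) \<Rightarrow>
    nat \<Rightarrow> nat \<Rightarrow> nat \<Rightarrow> nat \<Rightarrow> real" where
  "truncation_error \<alpha> D T F u N M n m =
    (let h = 1 / real N; \<tau> = T / real M; v = (\<lambda>i j. u (real i * h) (real j * \<tau>));
         \<delta> = (v (n - 1) m - 2 * v n m + v (n + 1) m) / h\<^sup>2
     in (if m = 1 then (v n 1 - v n 0) / (Gamma (2 - \<alpha>) * \<tau> powr \<alpha>)
         else 1 / (Gamma (1 - \<alpha>) * \<tau> powr \<alpha>) * (\<Sum>k=0..m. sigma \<alpha> m k * v n (m - k)))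
        - D * \<delta> - F (real n * h) (real m * \<tau>))"

definition max_error :: "real \<Rightarrow> (real \<Rightarrow> real \<Rightarrow> real) \<Rightarrow> nat \<Rightarrow> nat \<Rightarrow> (nat \<Rightarrow> nat \<Rightarrow> real) \<Rightarrow> nat \<Rightarrow> real" where
  "max_error T u N M U m =
     Max ((\<lambda>n. \<bar>u (real n * (1 / real N)) (real m * (T / real M)) - U n m\<bar>) ` {1..N-1})"

end

theory Submission
  imports Defs
begin

text \<open>
  Since the midpoint rule underestimates the integral of the convex function \<open>x powr - \<alpha>\<close>, the
  correction \<open>W \<alpha> m\<close> decreases, and the zeta terms are chosen so that its limit is \<open>0\<close>; hence
  \<open>0 \<le> W \<alpha> m \<le> m powr - \<alpha> / 2\<close>. As \<open>\<zeta>(\<alpha>) \<le> 0\<close>, all weights except the first are nonpositive,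
  they add up to \<open>0\<close>, and the last one is at most \<open>- m powr - \<alpha> / 2\<close>. The discrete maximum principle
  bounds \<open>\<sigma>\<^sub>0 \<parallel>\<E>\<^sup>m\<parallel>\<close> by \<open>- (\<Sum>k=1..m. \<sigma>\<^sub>k \<parallel>\<E>\<^sup>m\<^sup>-\<^sup>k\<parallel>)\<close> plus the scaled truncation error \<open>g\<close>. Because
  \<open>\<E>\<^sup>0 = 0\<close>, the last weight is free to absorb \<open>g\<close>, and \<open>\<parallel>\<E>\<^sup>m\<parallel> \<le> 2 m powr \<alpha> * g\<close> follows by induction.
\<close>

section \<open>Integral comparison\<close>

lemma powr_diff_mvt:
  fixes p a b :: real
  assumes "0 < p" "0 \<le> a" "a < b"
  obtains z where "a < z" "z < b" "b powr p - a powr p = (b - a) * (p * z powr (p - 1))"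
proof -
  have "\<exists>l z. a < z \<and> z < b \<and> ((\<lambda>x. x powr p) has_real_derivative l) (at z) \<and>
      b powr p - a powr p = (b - a) * l"
  proof (rule MVT[OF assms(3)])
    show "continuous_on {a..b} (\<lambda>x. x powr p)"
      using assms by (intro continuous_on_powr') (auto intro!: continuous_intros)
    show "(\<lambda>x. x powr p) differentiable (at x)" if "a < x" "x < b" for x
      using has_real_derivative_powr[of x p] that assms
      by (auto simp: real_differentiable_def)
  qed
  then obtain l z where z: "a < z" "z < b" "((\<lambda>x. x powr p) has_real_derivative l) (at z)"
      "b powr p - a powr p = (b - a) * l" by blast
  moreover have "l = p * z powr (p - 1)"
    using z has_real_derivative_powr[of z p] assms by (intro DERIV_unique[OF z(3)]) auto
  ultimately show ?thesis using that by blast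
qed

context
  fixes \<alpha> :: real
  assumes \<alpha>: "0 < \<alpha>" "\<alpha> < 1"
begin

text \<open>Antiderivative of \<open>x powr - \<alpha>\<close> for positive \<open>x\<close>, with
  \<open>prim 0 = 0\<close>; its differences stand in for integrals, including the improper ones
  from 0.\<close>

definition prim :: "real \<Rightarrow> real" where
  "prim x = x powr (1 - \<alpha>) / (1 - \<alpha>)"

lemma prim_diff_ge:
  assumes "0 \<le> a" "a < b"
  shows "(b - a) * b powr - \<alpha> \<le> prim b - prim a"
proof -
  obtain z where z: "a < z" "z < b" "b powr (1 - \<alpha>) - a powr (1 - \<alpha>) = (b - a) * ((1 - \<alpha>) * z powr - \<alpha>)"
    using powr_diff_mvt[of "1 - \<alpha>" a b] \<alpha> assms by auto
  have "prim b - prim a = (b - a) * z powr - \<alpha>"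
    using z(3) \<alpha> by (simp add: prim_def diff_divide_distrib[symmetric])
  moreover have "b powr - \<alpha> \<le> z powr - \<alpha>"
    using z \<alpha> assms by (intro powr_mono2') auto
  ultimately show ?thesis using assms by (simp add: mult_left_mono)
qed

text \<open>Positivity of \<open>a\<close> matters: \<open>0 powr - \<alpha>\<close> is 0 by
  convention, so this left-endpoint bound would be false at \<open>a = 0\<close>.\<close>

lemma prim_diff_le:
  assumes "0 < a" "a < b"
  shows "prim b - prim a \<le> (b - a) * a powr - \<alpha>"
proof -
  obtain z where z: "a < z" "z < b" "b powr (1 - \<alpha>) - a powr (1 - \<alpha>) = (b - a) * ((1 - \<alpha>) * z powr - \<alpha>)"
    using powr_diff_mvt[of "1 - \<alpha>" a b] \<alpha> assms by auto
  have "prim b - prim a = (b - a) * z powr - \<alpha>"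
    using z(3) \<alpha> by (simp add: prim_def diff_divide_distrib[symmetric])
  moreover have "z powr - \<alpha> \<le> a powr - \<alpha>"
    using z \<alpha> assms by (intro powr_mono2') auto
  ultimately show ?thesis using assms by (simp add: mult_left_mono)
qed

lemma DERIV_prim [derivative_intros]:
  assumes "(f has_real_derivative f') (at x)" "0 < f x"
  shows "((\<lambda>x. prim (f x)) has_real_derivative f x powr - \<alpha> * f') (at x)"
proof (rule DERIV_chain2[OF _ assms(1)])
  have "((\<lambda>y. y powr (1 - \<alpha>) / (1 - \<alpha>)) has_real_derivative (1 - \<alpha>) * f x powr (1 - \<alpha> - 1) / (1 - \<alpha>)) (at (f x))"
    by (intro DERIV_cdivide has_real_derivative_powr assms)
  then show "(prim has_real_derivative f x powr - \<alpha>) (at (f x))"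
    unfolding prim_def[abs_def] using \<alpha> by simp
qed

text \<open>Since \<open>(c + t) * (c - t) \<le> c * c\<close> and the power is antitone,
  \<open>c powr - \<alpha>\<close> lies below the geometric mean of the two outer values, hence
  below their arithmetic mean.\<close>

lemma powr_midpoint_convex:
  assumes "0 \<le> t" "t < c"
  shows "2 * c powr - \<alpha> \<le> (c + t) powr - \<alpha> + (c - t) powr - \<alpha>"
proof -
  define p where "p = (c + t) powr (- \<alpha> / 2)"
  define q where "q = (c - t) powr (- \<alpha> / 2)"
  have "c powr - \<alpha> = (c * c) powr (- \<alpha> / 2)"
    using assms by (simp add: powr_mult flip: powr_add)
  also have "\<dots> \<le> ((c + t) * (c - t)) powr (- \<alpha> / 2)"
    using assms \<alpha> by (intro powr_mono2') (auto simp: algebra_simps mult_strict_mono)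
  also have "\<dots> = p * q"
    using assms by (simp add: p_def q_def powr_mult)
  finally have "2 * c powr - \<alpha> \<le> 2 * p * q" by simp
  also have "\<dots> \<le> p\<^sup>2 + q\<^sup>2" by (rule sum_squares_bound)
  also have "\<dots> = (c + t) powr - \<alpha> + (c - t) powr - \<alpha>"
    using assms by (simp add: p_def q_def power2_eq_square flip: powr_add)
  finally show ?thesis .
qed

text \<open>As a function of the half-width, the difference of the two sides vanishes at 0, and its
  derivative is the gap in \<open>powr_midpoint_convex\<close>. The condition \<open>h < c\<close>
  keeps the interval away from 0.\<close>

lemma midpoint_le_prim_diff:
  assumes "0 < h" "h < c"
  shows "2 * h * c powr - \<alpha> \<le> prim (c + h) - prim (c - h)"
proof -
  define \<phi> where "\<phi> = (\<lambda>t. prim (c + t) - prim (c - t) - 2 * t * c powr - \<alpha>)"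
  have "\<phi> 0 \<le> \<phi> h"
  proof (rule DERIV_nonneg_imp_nondecreasing[of 0 h \<phi>])
    show "0 \<le> h" using assms by simp
    fix t assume t: "0 \<le> t" "t \<le> h"
    have "(\<phi> has_real_derivative ((c + t) powr - \<alpha> + (c - t) powr - \<alpha> - 2 * c powr - \<alpha>)) (at t)"
      unfolding \<phi>_def using t assms by (auto intro!: derivative_eq_intros)
    then show "\<exists>y. (\<phi> has_real_derivative y) (at t) \<and> 0 \<le> y"
      using powr_midpoint_convex[of t c] t assms by auto
  qed
  then show ?thesis by (simp add: \<phi>_def)
qed

section \<open>The zeta value and the correction\<close>

text \<open>Each real part of \<open>zeta_term\<close> compares a value with the integral over the
  next unit interval, and the integrals telescope. The pole term \<open>1 / (s - 1)\<close> equals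
  \<open>- prim 1\<close>, which moves the lower limit of integration from 1 to 0.\<close>

lemma rzeta_limit: "(\<lambda>n. (\<Sum>k=1..n. real k powr - \<alpha>) - prim n) \<longlonglongrightarrow> rzeta \<alpha>"
proof -
  let ?s = "complex_of_real \<alpha>"
  have Re_term: "Re (zeta_term n ?s) = real (Suc n) powr - \<alpha> - (prim (Suc (Suc n)) - prim (Suc n))" for n
  proof -
    have p: "of_nat k powr complex_of_real x = complex_of_real (real k powr x)" for k x
      using powr_of_real[of "real k" x] by simp
    have "zeta_term n ?s = complex_of_real (real (Suc n) powr - \<alpha> - (prim (Suc (Suc n)) - prim (Suc n)))"
      unfolding zeta_term_def prim_def
      using p[of "Suc n" \<alpha>] p[of "Suc n" "1 - \<alpha>"] p[of "Suc (Suc n)" "1 - \<alpha>"]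
      by (simp add: powr_minus divide_simps del: of_nat_Suc)
    then show ?thesis by (simp only: Re_complex_of_real)
  qed
  have "(\<lambda>n. Re (zeta_term n ?s)) sums Re (zeta ?s - 1 / (?s - 1))"
    using \<alpha> by (intro sums_Re zeta_term_sums) auto
  moreover have "Re (zeta ?s - 1 / (?s - 1)) = rzeta \<alpha> + prim 1"
  proof -
    have "1 / (?s - 1) = complex_of_real (1 / (\<alpha> - 1))" by simp
    then have "Re (zeta ?s - 1 / (?s - 1)) = rzeta \<alpha> - 1 / (\<alpha> - 1)"
      by (simp only: minus_complex.sel Re_complex_of_real rzeta_def)
    then show ?thesis using minus_divide_right[of 1 "\<alpha> - 1"] by (simp add: prim_def)
  qed
  ultimately have "(\<lambda>n. \<Sum>i<n. real (Suc i) powr - \<alpha> - (prim (Suc (Suc i)) - prim (Suc i))) \<longlonglongrightarrow> rzeta \<alpha> + prim 1"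
    unfolding sums_def Re_term by simp
  moreover have "(\<Sum>i<n. real (Suc i) powr - \<alpha> - (prim (Suc (Suc i)) - prim (Suc i))) =
      (\<Sum>k=1..n. real k powr - \<alpha>) - prim (Suc n) + prim 1" for n
    by (induction n) auto
  ultimately have "(\<lambda>n. (\<Sum>k=1..n. real k powr - \<alpha>) - prim (Suc n) + prim 1 - prim 1) \<longlonglongrightarrow> rzeta \<alpha> + prim 1 - prim 1"
    by (intro tendsto_diff tendsto_const) simp
  then have lim: "(\<lambda>n. (\<Sum>k=1..n. real k powr - \<alpha>) - prim (Suc n)) \<longlonglongrightarrow> rzeta \<alpha>" by simp
  \<comment> \<open>Telescoping ends at \<open>prim (Suc n)\<close>; the discrepancy from
    \<open>prim n\<close> is the integral over one unit interval.\<close>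
  have "(\<lambda>n. prim (Suc n) - prim n) \<longlonglongrightarrow> 0"
  proof (rule tendsto_sandwich[of "\<lambda>_. 0" _ _ "\<lambda>n. real n powr - \<alpha>"])
    show "(\<lambda>n. real n powr - \<alpha>) \<longlonglongrightarrow> 0"
      using \<alpha> by (intro tendsto_neg_powr filterlim_real_sequentially) auto
    show "\<forall>\<^sub>F n in sequentially. prim (Suc n) - prim n \<le> real n powr - \<alpha>"
      using eventually_gt_at_top[of 0]
    proof eventually_elim
      case (elim n)
      then show ?case using prim_diff_le[of "real n" "real (Suc n)"] by simp
    qed
    show "\<forall>\<^sub>F n in sequentially. 0 \<le> prim (Suc n) - prim n"
      using \<alpha> by (auto simp: prim_def divide_right_mono powr_mono2)
  qed auto
  from tendsto_add[OF lim this] show ?thesis by simp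
qed

text \<open>Right-endpoint sums underestimate the integral of a decreasing function, so every member
  of the sequence in \<open>rzeta_limit\<close> is nonpositive.\<close>

lemma rzeta_nonpos: "rzeta \<alpha> \<le> 0"
proof (rule LIMSEQ_le_const2[OF rzeta_limit], intro exI[of _ 0] allI impI)
  fix n :: nat
  show "(\<Sum>k=1..n. real k powr - \<alpha>) - prim n \<le> 0"
  proof (induction n)
    case (Suc n)
    then show ?case using prim_diff_ge[of "real n" "real (Suc n)"] by simp
  qed (simp add: prim_def)
qed

lemma half_shift_powr: "2 powr \<alpha> * (1 / (2 * real k - 1) powr \<alpha>) = (real k - 1 / 2) powr - \<alpha>" if "k \<ge> 1"
proof -
  have "(2 * real k - 1) powr \<alpha> = 2 powr \<alpha> * (real k - 1 / 2) powr \<alpha>"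
    using that by (simp flip: powr_mult add: algebra_simps)
  then show ?thesis by (simp add: powr_minus divide_simps)
qed

text \<open>Up to an additive constant, \<open>W\<close> is the error of the midpoint rule with unit
  step for \<open>x powr - \<alpha>\<close> on \<open>[0, m]\<close>, which opens its increments to
  the integral comparisons.\<close>

lemma W_eq:
  "W \<alpha> m = (1 - 2 powr \<alpha>) * rzeta \<alpha> - prim m + (\<Sum>k=1..m. (real k - 1 / 2) powr - \<alpha>)"
proof -
  have "2 powr \<alpha> * (\<Sum>k=1..m. 1 / (2 * real k - 1) powr \<alpha>) = (\<Sum>k=1..m. (real k - 1 / 2) powr - \<alpha>)"
    unfolding sum_distrib_left by (intro sum.cong refl half_shift_powr) auto
  then show ?thesis by (simp add: W_def prim_def algebra_simps)
qed

text \<open>The midpoint sum collects the odd terms, that is, all terms minus the even ones. So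
  \<open>W\<close> combines the zeta sequence \<open>H\<close> at \<open>2 * m\<close> and at
  \<open>m\<close>, and the three coefficients of \<open>rzeta \<alpha>\<close> in the limit add up
  to 0.\<close>

lemma W_limit: "W \<alpha> \<longlonglongrightarrow> 0"
proof -
  define H where "H = (\<lambda>n. (\<Sum>k=1..n. real k powr - \<alpha>) - prim n)"
  have odd: "(\<Sum>k=1..m. (real k - 1 / 2) powr - \<alpha>) =
      2 powr \<alpha> * (\<Sum>k=1..2*m. real k powr - \<alpha>) - (\<Sum>k=1..m. real k powr - \<alpha>)" for m
  proof (induction m)
    case (Suc m)
    have d: "2 powr \<alpha> * (2 * x) powr - \<alpha> = x powr - \<alpha>" if "x > 0" for x :: real
      using that by (simp add: powr_mult powr_minus)
    show ?case using Suc d[of "real m + 1"] d[of "real m + 1 / 2"]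
      by (simp add: algebra_simps)
  qed simp
  \<comment> \<open>By this scaling \<open>2 powr \<alpha> * prim (2 * m) - prim m\<close> is again
    \<open>prim m\<close>, so the integral in \<open>W\<close> splits into those of the two
    \<open>H\<close> terms.\<close>
  have "2 powr \<alpha> * prim (2 * x) = 2 * prim x" if "x \<ge> 0" for x
  proof -
    have "2 powr \<alpha> * 2 powr (1 - \<alpha>) = (2::real)" by (simp flip: powr_add)
    then show ?thesis using that by (simp add: prim_def powr_mult)
  qed
  then have "W \<alpha> m = (1 - 2 powr \<alpha>) * rzeta \<alpha> + 2 powr \<alpha> * H (2 * m) - H m" for m
    unfolding W_eq odd H_def by (simp add: algebra_simps)
  then have W: "W \<alpha> = (\<lambda>m. (1 - 2 powr \<alpha>) * rzeta \<alpha> + 2 powr \<alpha> * H (2 * m) - H m)" by blast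
  have H: "H \<longlonglongrightarrow> rzeta \<alpha>" unfolding H_def by (rule rzeta_limit)
  have "(\<lambda>m. H (2 * m)) \<longlonglongrightarrow> rzeta \<alpha>"
    using LIMSEQ_subseq_LIMSEQ[OF H, of "\<lambda>m. 2 * m"] by (simp add: strict_mono_def o_def)
  from tendsto_diff[OF tendsto_add[OF tendsto_const tendsto_mult[OF tendsto_const this]] H]
  have "W \<alpha> \<longlonglongrightarrow> (1 - 2 powr \<alpha>) * rzeta \<alpha> + 2 powr \<alpha> * rzeta \<alpha> - rzeta \<alpha>"
    unfolding W .
  then show ?thesis by (simp add: algebra_simps)
qed

lemma W_Suc: "W \<alpha> (Suc m) - W \<alpha> m = (real m + 1 / 2) powr - \<alpha> - (prim (Suc m) - prim m)"
  by (simp add: W_eq algebra_simps)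

text \<open>A decreasing sequence stays above its limit. The shift to \<open>n + 1\<close> leaves
  out the interval \<open>[0, 1]\<close>, which \<open>midpoint_le_prim_diff\<close> does not
  cover.\<close>

lemma W_nonneg:
  assumes "m \<ge> 1"
  shows "0 \<le> W \<alpha> m"
proof -
  have "decseq (\<lambda>n. W \<alpha> (n + 1))"
  proof (rule decseq_SucI)
    show "W \<alpha> (Suc n + 1) \<le> W \<alpha> (n + 1)" for n
      using W_Suc[of "n + 1"] midpoint_le_prim_diff[of "1 / 2" "real (n + 1) + 1 / 2"]
      by (simp add: algebra_simps)
  qed
  from decseq_ge[OF this LIMSEQ_ignore_initial_segment[OF W_limit, of 1], of "m - 1"] assms
  show ?thesis by simp
qed

text \<open>Subtracting half of \<open>real n powr - \<alpha>\<close> turns \<open>W\<close> into an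
  increasing sequence, still with limit 0.\<close>

lemma W_le:
  assumes "m \<ge> 1"
  shows "W \<alpha> m \<le> real m powr - \<alpha> / 2"
proof -
  define V where "V = (\<lambda>n. W \<alpha> n - real n powr - \<alpha> / 2)"
  have "incseq (\<lambda>n. V (n + 1))"
  proof (rule incseq_SucI)
    fix n
    define x where "x = real (n + 1)"
    have x: "x > 0" "real (Suc n + 1) = x + 1" by (auto simp: x_def)
    \<comment> \<open>Left-endpoint rule with two steps of length 1/2; its first summand is matched
      by the term \<open>x powr - \<alpha> / 2\<close> that \<open>V\<close> subtracts at
      \<open>x\<close>.\<close>
    have "prim (x + 1) - prim x \<le> x powr - \<alpha> / 2 + (x + 1 / 2) powr - \<alpha> / 2"
      using prim_diff_le[of x "x + 1 / 2"] prim_diff_le[of "x + 1 / 2" "x + 1"] x by simp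
    moreover have "(x + 1) powr - \<alpha> \<le> (x + 1 / 2) powr - \<alpha>"
      using \<alpha> x by (intro powr_mono2') auto
    moreover have "W \<alpha> (Suc n + 1) - W \<alpha> (n + 1) = (x + 1 / 2) powr - \<alpha> - (prim (x + 1) - prim x)"
      using W_Suc[of "n + 1"] unfolding x_def by (simp add: add_ac)
    ultimately show "V (n + 1) \<le> V (Suc n + 1)"
      unfolding V_def x(2) x_def[symmetric] by linarith
  qed
  moreover have "V \<longlonglongrightarrow> 0 - 0 / 2"
    unfolding V_def using \<alpha>
    by (intro tendsto_diff tendsto_divide W_limit tendsto_neg_powr filterlim_real_sequentially) auto
  ultimately have "V (m - 1 + 1) \<le> 0"
    using incseq_le[of "\<lambda>n. V (n + 1)" 0 "m - 1"] LIMSEQ_ignore_initial_segment[of V 0 1] by simp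
  then show ?thesis using assms by (simp add: V_def)
qed

section \<open>The weights\<close>

text \<open>Only \<open>k = 1\<close> involves the sign of the zeta value; from \<open>k = 2\<close>
  on the weights are differences of a decreasing function.\<close>

lemma sigma_tilde_nonpos:
  assumes "k \<ge> 1"
  shows "sigma_tilde \<alpha> k \<le> 0"
proof (cases "k = 1")
  case True
  have "(2 / 3) powr \<alpha> \<le> 2 powr \<alpha>" using \<alpha> by (intro powr_mono2) auto
  moreover have "(2 powr \<alpha> - 1) * rzeta \<alpha> \<le> 0"
    using \<alpha> rzeta_nonpos by (intro mult_nonneg_nonpos) (auto simp: ge_one_powr_ge_zero)
  ultimately show ?thesis using True by (simp add: sigma_tilde_def)
next
  case False
  have "(2 * real k + 1) powr - \<alpha> \<le> (2 * real k - 1) powr - \<alpha>"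
    using \<alpha> assms by (intro powr_mono2') auto
  then show ?thesis using False assms by (simp add: sigma_tilde_def mult_nonneg_nonpos)
qed

lemma sigma_nonpos:
  assumes "m \<ge> 2" "k \<ge> 1" "k < m"
  shows "sigma \<alpha> m k \<le> 0"
  using sigma_tilde_nonpos[of k] W_nonneg[of m] assms
  by (auto simp: sigma_def)

text \<open>The part without \<open>W\<close> is at most \<open>- (real m powr - \<alpha>)\<close>
  because \<open>m - 1 / 2\<close> lies left of \<open>m\<close>, and \<open>W\<close> gives back at
  most half of that.\<close>

lemma sigma_last_le:
  assumes "m \<ge> 2"
  shows "sigma \<alpha> m m \<le> - (real m powr - \<alpha> / 2)"
proof -
  have "real m powr - \<alpha> \<le> (real m - 1 / 2) powr - \<alpha>"
    using \<alpha> assms by (intro powr_mono2') auto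
  then show ?thesis
    using half_shift_powr[of m] W_le[of m] assms by (auto simp: sigma_def)
qed

text \<open>The zeta terms cancel between \<open>k = 0\<close> and \<open>k = 1\<close>; the rest
  telescopes.\<close>

lemma sum_sigma_tilde:
  assumes "m \<ge> 2"
  shows "(\<Sum>k<m. sigma_tilde \<alpha> k) = 2 powr \<alpha> / (2 * real m - 1) powr \<alpha>"
  using assms
proof (induction m rule: dec_induct)
  case base
  have "{..<2::nat} = {0, 1}" by auto
  then show ?case by (simp add: sigma_tilde_def powr_divide)
next
  case (step m)
  then show ?case by (simp add: sigma_tilde_def powr_minus algebra_simps divide_simps)
qed

text \<open>The discrete derivative annihilates constants: \<open>W\<close> cancels between the last
  two weights, and what remains of the last one cancels the telescoped sum.\<close>

lemma sum_sigma:
  assumes "m \<ge> 2"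
  shows "(\<Sum>k=0..m. sigma \<alpha> m k) = 0"
proof -
  obtain j where m: "m = Suc (Suc j)" using assms by (metis add_2_eq_Suc le_Suc_ex)
  have "(\<Sum>k=0..j. sigma \<alpha> m k) = (\<Sum>k<Suc j. sigma_tilde \<alpha> k)"
    by (intro sum.cong) (auto simp: sigma_def m)
  then have "(\<Sum>k=0..m. sigma \<alpha> m k) =
      (\<Sum>k<Suc j. sigma_tilde \<alpha> k) + sigma \<alpha> m (Suc j) + sigma \<alpha> m m"
    by (simp add: m)
  also have "\<dots> = (\<Sum>k<m. sigma_tilde \<alpha> k) - 2 powr \<alpha> / (2 * real m - 1) powr \<alpha>"
    by (simp add: sigma_def m)
  finally show ?thesis using sum_sigma_tilde[OF assms] by simp
qed

lemma sigma_0_pos: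
  assumes "m \<ge> 2"
  shows "0 < sigma \<alpha> m 0"
proof -
  have "(2 powr \<alpha> - 1) * rzeta \<alpha> \<le> 0"
    using \<alpha> rzeta_nonpos by (intro mult_nonneg_nonpos) (auto simp: ge_one_powr_ge_zero)
  moreover have "(0::real) < 2 powr \<alpha>" by simp
  ultimately have "0 < 2 powr \<alpha> - (2 powr \<alpha> - 1) * rzeta \<alpha>" by linarith
  then show ?thesis using assms by (simp add: sigma_def sigma_tilde_def)
qed

section \<open>Stability\<close>

text \<open>The first layer enters through its own hypothesis because its scheme has different
  weights; the recursion starts at layer 2.\<close>

lemma sigma_recursion_bound:
  fixes E :: "nat \<Rightarrow> real"
  assumes g: "0 \<le> g"
    and E0: "E 0 = 0"
    and E1: "M \<ge> 1 \<Longrightarrow> E 1 \<le> g"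
    and rec: "\<And>m. 2 \<le> m \<Longrightarrow> m \<le> M \<Longrightarrow> sigma \<alpha> m 0 * E m \<le> (\<Sum>k=1..m. - sigma \<alpha> m k * E (m - k)) + g"
    and m: "m \<le> M"
  shows "E m \<le> 2 * real m powr \<alpha> * g"
  using m
proof (induction m rule: less_induct)
  case (less m)
  consider "m = 0" | "m = 1" | "m \<ge> 2" by linarith
  then show ?case
  proof cases
    case 3
    \<comment> \<open>Scaled so that \<open>real m powr - \<alpha> / 2 * B = g\<close>: the slack in
      the last weight pays exactly for the truncation error.\<close>
    define B where "B = 2 * real m powr \<alpha> * g"
    have "B \<ge> 0" using g by (simp add: B_def)
    have le: "E (m - k) \<le> B" if "k \<in> {1..<m}" for k
    proof -
      have "E (m - k) \<le> 2 * real (m - k) powr \<alpha> * g"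
        using less.IH[of "m - k"] less.prems that by simp
      also have "\<dots> \<le> B"
        unfolding B_def using \<alpha> g by (intro mult_right_mono mult_left_mono powr_mono2) auto
      finally show ?thesis .
    qed
    have split: "(\<Sum>k=1..m. f k) = (\<Sum>k=1..<m. f k) + f m" for f :: "nat \<Rightarrow> real"
      using 3 by (simp add: atLeastLessThanSuc_atLeastAtMost[symmetric])
    have "(\<Sum>k=0..m. sigma \<alpha> m k) = sigma \<alpha> m 0 + (\<Sum>k=1..m. sigma \<alpha> m k)"
      by (simp add: sum.atLeast_Suc_atMost)
    then have sum: "(\<Sum>k=1..<m. - sigma \<alpha> m k) = sigma \<alpha> m 0 + sigma \<alpha> m m"
      using sum_sigma[OF 3] split[of "sigma \<alpha> m"] by (simp add: sum_negf)
    have "sigma \<alpha> m 0 * E m \<le> (\<Sum>k=1..m. - sigma \<alpha> m k * E (m - k)) + g"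
      using rec 3 less by blast
    \<comment> \<open>The term \<open>k = m\<close> drops out by \<open>E 0 = 0\<close>, but its
      weight still counts in the zero sum and so reappears as
      \<open>sigma \<alpha> m m * B\<close>.\<close>
    also have "(\<Sum>k=1..m. - sigma \<alpha> m k * E (m - k)) = (\<Sum>k=1..<m. - sigma \<alpha> m k * E (m - k))"
      by (subst split) (simp add: E0)
    also have "\<dots> \<le> (\<Sum>k=1..<m. - sigma \<alpha> m k * B)"
      using sigma_nonpos 3 le by (intro sum_mono mult_left_mono) auto
    also have "\<dots> = (sigma \<alpha> m 0 + sigma \<alpha> m m) * B"
      by (simp only: sum_distrib_right[symmetric] sum)
    also have "\<dots> \<le> (sigma \<alpha> m 0 - real m powr - \<alpha> / 2) * B"
      using sigma_last_le[OF 3] \<open>B \<ge> 0\<close> by (intro mult_right_mono) auto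
    also have "\<dots> = sigma \<alpha> m 0 * B - g"
      using 3 by (simp add: B_def algebra_simps powr_minus)
    finally have "sigma \<alpha> m 0 * E m \<le> sigma \<alpha> m 0 * B" by simp
    then show ?thesis using sigma_0_pos[OF 3] by (simp add: B_def)
  qed (use E0 E1 g less in auto)
qed

end

text \<open>At an index where the absolute value is largest, the two neighbours contribute at most
  \<open>2 * \<eta>\<close> times the maximum. The diagonal part \<open>2 * \<eta>\<close> offsets
  this and leaves \<open>s\<close>.\<close>

lemma discrete_max_principle:
  fixes e r :: "nat \<Rightarrow> real"
  assumes N: "N \<ge> 2" and "0 \<le> \<eta>" and bdry: "e 0 = 0" "e N = 0"
    and eq: "\<And>n. n \<in> {1..N-1} \<Longrightarrow> - \<eta> * e (n - 1) + (s + 2 * \<eta>) * e n - \<eta> * e (n + 1) = r n"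
    and r: "\<And>n. n \<in> {1..N-1} \<Longrightarrow> \<bar>r n\<bar> \<le> R"
  shows "s * Max ((\<lambda>n. \<bar>e n\<bar>) ` {1..N-1}) \<le> R"
proof -
  define E where "E = Max ((\<lambda>n. \<bar>e n\<bar>) ` {1..N-1})"
  have "E \<in> (\<lambda>n. \<bar>e n\<bar>) ` {1..N-1}"
    unfolding E_def using N by (intro Max_in) auto
  then obtain n where n: "n \<in> {1..N-1}" "E = \<bar>e n\<bar>" by blast
  have le: "\<bar>e k\<bar> \<le> E" if "k \<le> N" for k
  proof (cases "k = 0 \<or> k = N")
    case True
    \<comment> \<open>A neighbour of the maximiser may be a boundary node, so the bound has to reach
      \<open>0\<close> and \<open>N\<close> as well.\<close>
    then show ?thesis using bdry n by auto
  next
    case False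
    then show ?thesis unfolding E_def using that by (intro Max_ge) auto
  qed
  have "s * e n + 2 * \<eta> * e n = r n + \<eta> * (e (n - 1) + e (n + 1))"
    using eq[OF n(1)] by (simp add: algebra_simps)
  moreover have "s * E + 2 * \<eta> * E \<le> \<bar>s * e n + 2 * \<eta> * e n\<bar>"
    using abs_ge_self[of "s + 2 * \<eta>"]
    by (simp add: n(2) abs_mult mult_right_mono flip: distrib_right)
  moreover have "\<bar>\<eta> * (e (n - 1) + e (n + 1))\<bar> \<le> \<eta> * (2 * E)"
  proof -
    have "\<bar>e (n - 1) + e (n + 1)\<bar> \<le> 2 * E"
    proof -
      have "n - 1 \<le> N" "n + 1 \<le> N" using n(1) N by auto
      from this[THEN le] show ?thesis by linarith
    qed
    then show ?thesis using \<open>0 \<le> \<eta>\<close> by (simp add: abs_mult mult_left_mono)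
  qed
  ultimately show ?thesis
    using r[OF n(1)] unfolding E_def[symmetric] by linarith
qed

section \<open>Error equation and convergence estimate\<close>

theorem theorem4:
  fixes \<alpha> D T :: real
    and F u :: "real \<Rightarrow> real \<Rightarrow> real" and u0 u1 u2 :: "real \<Rightarrow> real"
    and A' B' :: "nat \<Rightarrow> nat \<Rightarrow> nat \<Rightarrow> nat \<Rightarrow> real" and C :: real
  assumes "0 < \<alpha>" "\<alpha> < 1" "D > 0" "T > 0"
    and "subdiffusion_solution \<alpha> D T F u0 u1 u2 u"
    and "\<And>N M n m. N \<ge> 2 \<Longrightarrow> M \<ge> 1 \<Longrightarrow> n \<in> {1..N-1} \<Longrightarrow> m \<in> {1..M} \<Longrightarrow>
           truncation_error \<alpha> D T F u N M n m =
             A' N M n m * (T / real M) powr (2 - \<alpha>) + B' N M n m * (1 / real N)\<^sup>2"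
    and "\<And>N M n m. N \<ge> 2 \<Longrightarrow> M \<ge> 1 \<Longrightarrow> n \<in> {1..N-1} \<Longrightarrow> m \<in> {1..M} \<Longrightarrow>
           \<bar>A' N M n m\<bar> \<le> C \<and> \<bar>B' N M n m\<bar> \<le> C"
  shows "\<exists>A>0. \<forall>N\<ge>2. \<forall>M\<ge>1. \<forall>U. numerical_solution \<alpha> D T F u0 u1 u2 N M U \<longrightarrow>
           (\<forall>m\<in>{1..M}. max_error T u N M U m \<le>
              2 * A * real m powr \<alpha> * (T / real M) powr \<alpha> *
                ((T / real M) powr (2 - \<alpha>) + (1 / real N)\<^sup>2))"
proof -
  define G where "G = Gamma (1 - \<alpha>)"
  \<comment> \<open>The factor \<open>G\<close> appears when the error equation is multiplied by
    \<open>G * \<tau> powr \<alpha>\<close>; \<open>max C 1\<close> keeps \<open>A\<close> positive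
    even if \<open>C\<close> is 0.\<close>
  define A where "A = G * max C 1"
  have "G > 0" unfolding G_def using assms(2) by (intro Gamma_real_pos) auto
  \<comment> \<open>Hence \<open>Gamma (2 - \<alpha>) \<le> G\<close>, so the scaled truncation
    error of the first layer obeys the same bound \<open>g\<close> as the later ones.\<close>
  have G2: "Gamma (2 - \<alpha>) = (1 - \<alpha>) * G"
    using Gamma_plus1[of "1 - \<alpha>"] assms(2) by (fastforce simp: G_def elim!: nonpos_Ints_cases)
  have "A > 0" using \<open>G > 0\<close> by (simp add: A_def)
  show ?thesis
  proof (intro exI[of _ A] conjI allI impI ballI \<open>A > 0\<close>)
    fix N M m :: nat and U
    assume N: "2 \<le> N" and M: "1 \<le> M" and U: "numerical_solution \<alpha> D T F u0 u1 u2 N M U"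
      and m: "m \<in> {1..M}"
    define h where "h = 1 / real N"
    define \<tau> where "\<tau> = T / real M"
    define e where "e = (\<lambda>n m. u (real n * h) (real m * \<tau>) - U n m)"
    define E where "E = max_error T u N M U"
    define \<rho> where "\<rho> = truncation_error \<alpha> D T F u N M"
    define g where "g = A * \<tau> powr \<alpha> * (\<tau> powr (2 - \<alpha>) + h\<^sup>2)"
    have h: "0 < h" and \<tau>: "0 < \<tau>" using N M assms(4) by (auto simp: h_def \<tau>_def)
    have "0 \<le> g" using \<open>A > 0\<close> by (simp add: g_def)
    have E: "E m = Max ((\<lambda>n. \<bar>e n m\<bar>) ` {1..N-1})" for m
      by (simp add: E_def max_error_def e_def h_def \<tau>_def)
    have E_ge: "\<bar>e n m\<bar> \<le> E m" if "n \<in> {1..N-1}" for n m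
      unfolding E using that by (intro Max_ge) auto
    have \<tau>m: "real m * \<tau> \<in> {0..T}" if "m \<le> M" for m
    proof -
      have "real m * T \<le> real M * T" using that assms(4) by (intro mult_right_mono) auto
      then show ?thesis using assms(4) M by (auto simp: \<tau>_def divide_simps mult_ac)
    qed
    have hn: "real n * h \<in> {0..1}" if "n \<le> N" for n
      using that N by (auto simp: h_def)
    have hN: "real N * h = 1" using N by (simp add: h_def)
    have U0: "U n 0 = u0 (real n * h)" if "n \<le> N" for n
      using U that by (auto simp: numerical_solution_def Let_def h_def)
    have Ub: "U 0 m = u1 (real m * \<tau>)" "U N m = u2 (real m * \<tau>)" if "m \<le> M" for m
      using U that by (auto simp: numerical_solution_def Let_def h_def \<tau>_def)
    have ub: "u x 0 = u0 x" "u 0 t = u1 t" "u 1 t = u2 t" if "x \<in> {0..1}" "t \<in> {0..T}" for x t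
      using assms(5) that by (auto simp: subdiffusion_solution_def)
    have e0: "e n 0 = 0" if "n \<le> N" for n
      using U0[OF that] ub(1)[OF hn[OF that], of 0] assms(4) by (simp add: e_def)
    have eb: "e 0 m = 0" "e N m = 0" if "m \<le> M" for m
      using Ub[OF that] ub(2,3)[OF _ \<tau>m[OF that], of 0] by (auto simp: e_def hN)
    have \<rho>: "G * \<tau> powr \<alpha> * \<bar>\<rho> n m\<bar> \<le> g" if "n \<in> {1..N-1}" "m \<in> {1..M}" for n m
    proof -
      have "\<bar>\<rho> n m\<bar> \<le> \<bar>A' N M n m\<bar> * \<tau> powr (2 - \<alpha>) + \<bar>B' N M n m\<bar> * h\<^sup>2"
        unfolding \<rho>_def assms(6)[OF N M that] \<tau>_def h_def
        by (rule order_trans[OF abs_triangle_ineq]) (simp add: abs_mult)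
      also have "\<dots> \<le> max C 1 * \<tau> powr (2 - \<alpha>) + max C 1 * h\<^sup>2"
        using assms(7)[OF N M that] by (intro add_mono mult_right_mono) auto
      finally have "\<bar>\<rho> n m\<bar> \<le> max C 1 * (\<tau> powr (2 - \<alpha>) + h\<^sup>2)"
        by (simp add: distrib_left)
      then have "G * \<tau> powr \<alpha> * \<bar>\<rho> n m\<bar> \<le> G * \<tau> powr \<alpha> * (max C 1 * (\<tau> powr (2 - \<alpha>) + h\<^sup>2))"
        using \<open>G > 0\<close> by (intro mult_left_mono) auto
      then show ?thesis by (simp add: g_def A_def mult_ac)
    qed
    have E0: "E 0 = 0"
    proof -
      have "E 0 \<in> (\<lambda>n. \<bar>e n 0\<bar>) ` {1..N-1}"
        unfolding E using N by (intro Max_in) auto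
      then show ?thesis using e0 by auto
    qed
    have E1: "E 1 \<le> g"
    proof -
      define c where "c = Gamma (2 - \<alpha>) * \<tau> powr \<alpha>"
      define \<eta> where "\<eta> = c * D / h\<^sup>2"
      have c: "0 < c" "c \<le> G * \<tau> powr \<alpha>"
        using assms(1,2) \<open>G > 0\<close> \<tau> by (auto simp: c_def G2 mult_right_mono)
      \<comment> \<open>On the first layer \<open>s = 1\<close>; the previous error
        \<open>e n 0\<close> vanishes, so only the scaled truncation error is left on the
        right.\<close>
      have "1 * Max ((\<lambda>n. \<bar>e n 1\<bar>) ` {1..N-1}) \<le> g"
      proof (rule discrete_max_principle[OF N])
        show "0 \<le> \<eta>" using c assms(3) by (simp add: \<eta>_def)
        show "e 0 1 = 0" "e N 1 = 0" using eb M by auto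
        fix n assume n: "n \<in> {1..N-1}"
        define v where "v = (\<lambda>i j. u (real i * h) (real j * \<tau>))"
        have sch: "- \<eta> * U (n - 1) 1 + (1 + 2 * \<eta>) * U n 1 - \<eta> * U (n + 1) 1 =
            U n 0 + c * F (real n * h) (1 * \<tau>)"
          using U n by (simp add: numerical_solution_def Let_def \<eta>_def c_def h_def \<tau>_def mult_ac)
        have tr: "\<rho> n 1 = (v n 1 - v n 0) / c - D * ((v (n - 1) 1 - 2 * v n 1 + v (n + 1) 1) / h\<^sup>2) -
            F (real n * h) (1 * \<tau>)"
          by (simp add: \<rho>_def truncation_error_def Let_def v_def c_def h_def \<tau>_def)
        \<comment> \<open>Multiplying by \<open>c\<close> clears the time denominator and turns
          \<open>D / h\<^sup>2\<close> into \<open>\<eta>\<close>; subtracting the scheme then gives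
          an equation for \<open>e\<close>.\<close>
        have "c * \<rho> n 1 = v n 1 - v n 0 - \<eta> * (v (n - 1) 1 - 2 * v n 1 + v (n + 1) 1) -
            c * F (real n * h) (1 * \<tau>)"
          using c unfolding tr
          by (simp add: \<eta>_def right_diff_distrib[of c] diff_divide_distrib mult.assoc)
        moreover have "v n 0 = U n 0" using e0[of n] n by (auto simp: e_def v_def)
        ultimately show "- \<eta> * e (n - 1) 1 + (1 + 2 * \<eta>) * e n 1 - \<eta> * e (n + 1) 1 = c * \<rho> n 1"
          using sch unfolding e_def v_def[symmetric] by (simp add: v_def algebra_simps)
        have "\<bar>c * \<rho> n 1\<bar> \<le> G * \<tau> powr \<alpha> * \<bar>\<rho> n 1\<bar>"
          using c by (simp add: abs_mult mult_right_mono)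
        then show "\<bar>c * \<rho> n 1\<bar> \<le> g" using \<rho>[OF n, of 1] M by simp
      qed
      then show ?thesis by (simp add: E)
    qed
    have rec: "sigma \<alpha> m 0 * E m \<le> (\<Sum>k=1..m. - sigma \<alpha> m k * E (m - k)) + g"
      if m: "2 \<le> m" "m \<le> M" for m
    proof -
      define c where "c = G * \<tau> powr \<alpha>"
      define \<eta> where "\<eta> = c * D / h\<^sup>2"
      have c: "0 < c" using \<open>G > 0\<close> \<tau> by (simp add: c_def)
      show ?thesis
        \<comment> \<open>Only layer \<open>m\<close> is unfolded into a maximum; the earlier layers
          go into the bound on the right-hand side.\<close>
        unfolding E[of m]
      proof (rule discrete_max_principle[OF N])
        show "0 \<le> \<eta>" using c assms(3) by (simp add: \<eta>_def)
        show "e 0 m = 0" "e N m = 0" using eb m by auto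
        fix n assume n: "n \<in> {1..N-1}"
        define v where "v = (\<lambda>i j. u (real i * h) (real j * \<tau>))"
        have split: "(\<Sum>k=0..m. f k) = f 0 + (\<Sum>k=1..m. f k)" for f :: "nat \<Rightarrow> real"
          by (simp add: sum.atLeast_Suc_atMost)
        have sch: "- \<eta> * U (n - 1) m + (sigma \<alpha> m 0 + 2 * \<eta>) * U n m - \<eta> * U (n + 1) m =
            - (\<Sum>k=1..m. sigma \<alpha> m k * U n (m - k)) + c * F (real n * h) (real m * \<tau>)"
          using U n m
          by (simp add: numerical_solution_def Let_def \<eta>_def c_def G_def h_def \<tau>_def mult_ac)
        have tr: "\<rho> n m = 1 / c * (\<Sum>k=0..m. sigma \<alpha> m k * v n (m - k)) -
            D * ((v (n - 1) m - 2 * v n m + v (n + 1) m) / h\<^sup>2) - F (real n * h) (real m * \<tau>)"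
          using m by (simp add: \<rho>_def truncation_error_def Let_def v_def c_def G_def h_def \<tau>_def)
        have e_eq: "e i m = v i m - U i m" for i by (simp add: e_def v_def)
        have "c * \<rho> n m = sigma \<alpha> m 0 * v n m + (\<Sum>k=1..m. sigma \<alpha> m k * v n (m - k)) -
            \<eta> * (v (n - 1) m - 2 * v n m + v (n + 1) m) - c * F (real n * h) (real m * \<tau>)"
          using c unfolding tr split by (simp add: \<eta>_def right_diff_distrib[of c])
        moreover have "(\<Sum>k=1..m. sigma \<alpha> m k * e n (m - k)) =
            (\<Sum>k=1..m. sigma \<alpha> m k * v n (m - k)) - (\<Sum>k=1..m. sigma \<alpha> m k * U n (m - k))"
          by (simp add: e_def v_def right_diff_distrib sum_subtractf)
        ultimately show "- \<eta> * e (n - 1) m + (sigma \<alpha> m 0 + 2 * \<eta>) * e n m - \<eta> * e (n + 1) m =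
            c * \<rho> n m - (\<Sum>k=1..m. sigma \<alpha> m k * e n (m - k))"
          using sch unfolding e_eq by (simp add: algebra_simps)
        have "\<bar>\<Sum>k=1..m. sigma \<alpha> m k * e n (m - k)\<bar> \<le> (\<Sum>k=1..m. \<bar>sigma \<alpha> m k * e n (m - k)\<bar>)"
          by (rule sum_abs)
        also have "\<dots> \<le> (\<Sum>k=1..m. - sigma \<alpha> m k * E (m - k))"
        proof (rule sum_mono)
          fix k assume k: "k \<in> {1..m}"
          \<comment> \<open>The sign makes \<open>- sigma \<alpha> m k\<close> the absolute value of
            the weight. The case \<open>k = m\<close> is separate since \<open>sigma_nonpos\<close>
            stops at \<open>m - 1\<close>.\<close>
          have "sigma \<alpha> m k \<le> 0"
          proof (cases "k = m")
            case True
            have "0 \<le> real m powr - \<alpha>" by simp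
            then show ?thesis using sigma_last_le[OF assms(1,2) m(1)] unfolding True by linarith
          qed (use k m sigma_nonpos[OF assms(1,2) m(1)] in auto)
          then show "\<bar>sigma \<alpha> m k * e n (m - k)\<bar> \<le> - sigma \<alpha> m k * E (m - k)"
            using E_ge[OF n, of "m - k"] by (simp add: abs_mult mult_left_mono_neg)
        qed
        finally have "\<bar>\<Sum>k=1..m. sigma \<alpha> m k * e n (m - k)\<bar> \<le> (\<Sum>k=1..m. - sigma \<alpha> m k * E (m - k))" .
        moreover have "\<bar>c * \<rho> n m\<bar> \<le> g"
          using \<rho>[OF n, of m] m c by (simp add: abs_mult c_def[symmetric])
        ultimately show "\<bar>c * \<rho> n m - (\<Sum>k=1..m. sigma \<alpha> m k * e n (m - k))\<bar> \<le>
            (\<Sum>k=1..m. - sigma \<alpha> m k * E (m - k)) + g"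
          by linarith
      qed
    qed
    have "E m \<le> 2 * real m powr \<alpha> * g"
      using sigma_recursion_bound[OF assms(1,2) \<open>0 \<le> g\<close> E0 E1 rec] m by auto
    then show "max_error T u N M U m \<le> 2 * A * real m powr \<alpha> * (T / real M) powr \<alpha> *
        ((T / real M) powr (2 - \<alpha>) + (1 / real N)\<^sup>2)"
      by (simp add: E_def g_def \<tau>_def h_def mult_ac)
  qed
qed

end
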